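(* Let $p$ be an odd prime. Up to cohomologous (that is, up to multiplication by a coboundary), every $2$-cocycle $\alpha$ of $\mathbb{H}_{3}\big(\mathbb{Z}/p\mathbb{Z} \times \mathbb{Z}/p\mathbb{Z} \big)$ with values in $\mathbb{C}^\times$ is of the following form: $$\alpha \big(x_1^{a_1}x_2^{a_2}y_1^{b_1}y_2^{b_2}z_1^{c_1}z_2^{c_2},\, x_1^{a_1'}x_2^{a_2'}y_1^{b_1'}y_2^{b_2'}z_1^{c_1'}z_2^{c_2'}\big)=\lambda_1^{c_1'a_1+b_1\binom{a_1'}{2}+a_1b_1a_1'}\,\lambda_2^{c_1'b_1+a_1'\binom{b_1}{2}}\, \lambda_3^{c_{2}'a_{2}+b_{2}\binom{a_{2}'}{2}+a_{2}b_{2}a_{2}'}\,\lambda_4^{c_{2}'b_{2}+a_{2}'\binom{b_{2}}{2}}\,\lambda_5^{a_1'a_{2}}\,\lambda_6^{a_1'b_{2}}\,\lambda_7^{b_1'a_2}\,\lambda_8^{b_1'b_2},$$ where $\lambda_i \in \mathbb{C}^\times$ satisfy $\lambda_i^p=1$ for $1\le i\le 8$.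
   Context: $\mathbb{H}_3(R)$ is the group of upper unitriangular $3\times 3$ matrices over the commutative ring $R$. For $R=\mathbb{Z}/p\mathbb{Z}\times\mathbb{Z}/p\mathbb{Z}$ (with componentwise operations), the symbol $x_1^{a_1}x_2^{a_2}y_1^{b_1}y_2^{b_2}z_1^{c_1}z_2^{c_2}$ (with $a_i,b_i,c_i\in\mathbb{Z}/p\mathbb{Z}$) denotes the matrix $\begin{pmatrix}1&(b_1,b_2)&(c_1,c_2)\\0&1&(a_1,a_2)\\0&0&1\end{pmatrix}$. $\binom{a}{2}=a(a-1)/2$, computed in $\mathbb{Z}/p\mathbb{Z}$. 2-cocycles are for the trivial action of the group on $\mathbb{C}^\times$. *)

theory Defs
  imports
    "HOL-Number_Theory.Residues"
    "HOL-Algebra.Chinese_Remainder"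
    "Jordan_Normal_Form.Matrix"
begin

text \<open>
  The multiplication on the type of matrices from \<open>Jordan_Normal_Form\<close> uses the ring structure of
  the entry type. Here the entries come from a ring given by a carrier set and explicit
  operations, so the matrix product is written out over that ring.
  Rows and columns are indexed by 0, 1, 2.
\<close>

definition unitriangular3 :: "('a, 'm) ring_scheme \<Rightarrow> 'a mat set" where
  "unitriangular3 R = {A \<in> carrier_mat 3 3.
     (\<forall>i<3. \<forall>j<3. A $$ (i, j) \<in> carrier R) \<and>
     (\<forall>i<3. A $$ (i, i) = \<one>\<^bsub>R\<^esub>) \<and>
     (\<forall>i<3. \<forall>j<i. A $$ (i, j) = \<zero>\<^bsub>R\<^esub>)}"

definition H3 :: "('a, 'm) ring_scheme \<Rightarrow> 'a mat monoid" where
  "H3 R = \<lparr>carrier = unitriangular3 R,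
     monoid.mult = (\<lambda>A B. mat 3 3 (\<lambda>(i, j). \<Oplus>\<^bsub>R\<^esub>k\<in>{..<3}. A $$ (i, k) \<otimes>\<^bsub>R\<^esub> B $$ (k, j))),
     one = mat 3 3 (\<lambda>(i, j). if i = j then \<one>\<^bsub>R\<^esub> else \<zero>\<^bsub>R\<^esub>)\<rparr>"

text \<open>
  The element \<open>x\<^sub>1\<^bsup>a1\<^esup> x\<^sub>2\<^bsup>a2\<^esup> y\<^sub>1\<^bsup>b1\<^esup> y\<^sub>2\<^bsup>b2\<^esup> z\<^sub>1\<^bsup>c1\<^esup> z\<^sub>2\<^bsup>c2\<^esup>\<close> of the group over \<open>S \<times> S\<close>: the exponents of the
  \<open>x\<^sub>i\<close> are in the second row and those of the \<open>y\<^sub>i\<close> are in the first row.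
\<close>

definition H3_elem :: "('a, 'm) ring_scheme \<Rightarrow> 'a \<Rightarrow> 'a \<Rightarrow> 'a \<Rightarrow> 'a \<Rightarrow> 'a \<Rightarrow> 'a \<Rightarrow> ('a \<times> 'a) mat" where
  "H3_elem S a1 a2 b1 b2 c1 c2 = (let R = RDirProd S S in
     mat_of_rows_list 3
       [[\<one>\<^bsub>R\<^esub>,  (b1, b2),  (c1, c2)],
        [\<zero>\<^bsub>R\<^esub>,  \<one>\<^bsub>R\<^esub>,      (a1, a2)],
        [\<zero>\<^bsub>R\<^esub>,  \<zero>\<^bsub>R\<^esub>,      \<one>\<^bsub>R\<^esub>]])"

definition choose2 :: "('a, 'm) ring_scheme \<Rightarrow> 'a \<Rightarrow> 'a" where
  "choose2 S a = a \<otimes>\<^bsub>S\<^esub> (a \<ominus>\<^bsub>S\<^esub> \<one>\<^bsub>S\<^esub>) \<otimes>\<^bsub>S\<^esub> inv\<^bsub>S\<^esub> (\<one>\<^bsub>S\<^esub> \<oplus>\<^bsub>S\<^esub> \<one>\<^bsub>S\<^esub>)"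

text \<open>
  2-cocycles and coboundaries for the trivial action on the multiplicative group of
  \<open>complex\<close>, not assumed normalized. Values outside the carrier are irrelevant.
\<close>

definition two_cocycle :: "('a, 'm) monoid_scheme \<Rightarrow> ('a \<Rightarrow> 'a \<Rightarrow> complex) \<Rightarrow> bool" where
  "two_cocycle G \<alpha> \<longleftrightarrow>
     (\<forall>g\<in>carrier G. \<forall>h\<in>carrier G. \<alpha> g h \<noteq> 0) \<and>
     (\<forall>g\<in>carrier G. \<forall>h\<in>carrier G. \<forall>k\<in>carrier G.
        \<alpha> g h * \<alpha> (g \<otimes>\<^bsub>G\<^esub> h) k = \<alpha> g (h \<otimes>\<^bsub>G\<^esub> k) * \<alpha> h k)"

definition coboundary :: "('a, 'm) monoid_scheme \<Rightarrow> ('a \<Rightarrow> complex) \<Rightarrow> 'a \<Rightarrow> 'a \<Rightarrow> complex" where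
  "coboundary G \<mu> g h = \<mu> g * \<mu> h / \<mu> (g \<otimes>\<^bsub>G\<^esub> h)"

definition cohomologous ::
    "('a, 'm) monoid_scheme \<Rightarrow> ('a \<Rightarrow> 'a \<Rightarrow> complex) \<Rightarrow> ('a \<Rightarrow> 'a \<Rightarrow> complex) \<Rightarrow> bool" where
  "cohomologous G \<alpha> \<beta> \<longleftrightarrow>
     (\<exists>\<mu>. (\<forall>g\<in>carrier G. \<mu> g \<noteq> 0) \<and>
          (\<forall>g\<in>carrier G. \<forall>h\<in>carrier G. \<alpha> g h = \<beta> g h * coboundary G \<mu> g h))"

text \<open>
  The power \<open>l\<^bsup>e\<^esup>\<close> for a residue class \<open>e\<close> modulo \<open>p\<close>, represented in \<open>residue_ring p\<close> by an integer
  in \<open>{0..p - 1}\<close>; it depends only on the class when \<open>l ^ p = 1\<close>.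
\<close>

definition rpow :: "complex \<Rightarrow> int \<Rightarrow> complex" (infixr "[^^]" 80) where
  "l [^^] e = l ^ nat e"

end

theory Submission
  imports Defs
begin

text \<open>
  A 2-cocycle \<open>\<alpha>\<close> of \<open>G\<close> turns the formal multiples \<open>s \<cdot> g\<close> (\<open>s\<close> complex, \<open>g \<in> G\<close>) into a monoid with
  product \<open>(s \<cdot> g) (t \<cdot> h) = s t \<alpha>(g, h) \<cdot> g h\<close>, the monomials of the twisted group algebra. Choosing a
  nonzero multiple \<open>W(g)\<close> of each \<open>g\<close> replaces \<open>\<alpha>\<close> by a cohomologous cocycle, which is read off from
  \<open>W(g) W(h) = \<beta>(g, h) W(g h)\<close>. So it suffices to find lifts whose products can be computed.

  Complex \<open>p\<close>-th roots exist, so \<open>x\<^sub>i\<close> and \<open>y\<^sub>i\<close> have lifts \<open>X\<^sub>i\<close> and \<open>Y\<^sub>i\<close> with \<open>p\<close>-th power 1. The lift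
  \<open>Z\<^sub>i\<close> of \<open>z\<^sub>i\<close> is then forced by \<open>Y\<^sub>i X\<^sub>i = Z\<^sub>i X\<^sub>i Y\<^sub>i\<close>. Lifts of commuting elements commute up to a scalar,
  and this scalar is a \<open>p\<close>-th root of unity as soon as one of the two lifts has \<open>p\<close>-th power 1:
  \<open>X\<^sub>1 Z\<^sub>1 = \<lambda>\<^sub>1 Z\<^sub>1 X\<^sub>1\<close> and \<open>Y\<^sub>1 Z\<^sub>1 = \<lambda>\<^sub>2 Z\<^sub>1 Y\<^sub>1\<close>, similarly \<open>\<lambda>\<^sub>3\<close>, \<open>\<lambda>\<^sub>4\<close> for the second factor, and
  \<open>\<lambda>\<^sub>5, \<dots>, \<lambda>\<^sub>8\<close> for \<open>X\<^sub>2\<close>, \<open>Y\<^sub>2\<close> against \<open>X\<^sub>1\<close>, \<open>Y\<^sub>1\<close>. No further scalars occur: \<open>Z\<^sub>1\<close> is a commutator of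
  \<open>X\<^sub>1\<close> and \<open>Y\<^sub>1\<close>, so the scalars by which \<open>X\<^sub>2\<close> and \<open>Y\<^sub>2\<close> pass it cancel (\<open>commute_with_commutator\<close>).
  Moreover \<open>Z\<^sub>i\<^sup>p = 1\<close>: expanding \<open>Y\<^sub>i X\<^sub>i\<^sup>p = (Z\<^sub>i X\<^sub>i)\<^sup>p Y\<^sub>i\<close> leaves the scalar \<open>\<lambda>\<close> to the power \<open>p\<close> choose 2,
  which is 1 because \<open>p\<close> is odd (\<open>heisenberg_lift\<close>).

  Hence \<open>W = Z\<^sub>1\<^bsup>c1\<^esup> X\<^sub>1\<^bsup>a1\<^esup> Y\<^sub>1\<^bsup>b1\<^esup> Z\<^sub>2\<^bsup>c2\<^esup> X\<^sub>2\<^bsup>a2\<^esup> Y\<^sub>2\<^bsup>b2\<^esup>\<close> depends only on the exponents modulo \<open>p\<close>, and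
  sorting the letters of a product of two such words (\<open>word_mult\<close> inside each factor, \<open>word_commute\<close>
  across the factors) produces precisely the asserted product of powers of the \<open>\<lambda>\<^sub>i\<close>
  (\<open>cocycle_normal_form\<close>).
\<close>

section \<open>Commutation up to scalars\<close>

context monoid
begin

text \<open>
  Putting the central letter first is what makes the exponents in \<open>word_mult\<close> below come out in the
  desired shape; other orders give cohomologous but different formulas.
\<close>

definition word :: "'a \<Rightarrow> 'a \<Rightarrow> 'a \<Rightarrow> nat \<Rightarrow> nat \<Rightarrow> nat \<Rightarrow> 'a" where
  "word z x y c a b = z [^] c \<otimes> x [^] a \<otimes> y [^] b"

lemma word_closed [simp]:
  "\<lbrakk>z \<in> carrier G; x \<in> carrier G; y \<in> carrier G\<rbrakk> \<Longrightarrow> word z x y c a b \<in> carrier G"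
  by (simp add: word_def)

end

text \<open>
  The scalars act as if they were central elements of the monoid, but need not lie in it.
\<close>

locale monoid_with_scalars = monoid E for E (structure) +
  fixes scal :: "'k::comm_monoid_mult \<Rightarrow> 'a \<Rightarrow> 'a" (infixr "\<star>" 75)
  assumes scal_closed [simp, intro]: "x \<in> carrier E \<Longrightarrow> k \<star> x \<in> carrier E"
    and scal_one [simp]: "x \<in> carrier E \<Longrightarrow> 1 \<star> x = x"
    and scal_scal [simp]: "x \<in> carrier E \<Longrightarrow> k \<star> l \<star> x = (k * l) \<star> x"
    and scal_mult_left [simp]:
      "\<lbrakk>x \<in> carrier E; y \<in> carrier E\<rbrakk> \<Longrightarrow> (k \<star> x) \<otimes> y = k \<star> (x \<otimes> y)"
    and scal_mult_right [simp]:
      "\<lbrakk>x \<in> carrier E; y \<in> carrier E\<rbrakk> \<Longrightarrow> x \<otimes> (k \<star> y) = k \<star> (x \<otimes> y)"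
begin

lemma scal_pow: "x \<in> carrier E \<Longrightarrow> (k \<star> x) [^] (n::nat) = k ^ n \<star> (x [^] n)"
  by (induction n) (simp_all add: mult.commute)

definition commute_upto :: "'k \<Rightarrow> 'a \<Rightarrow> 'a \<Rightarrow> bool" where
  "commute_upto k y x \<longleftrightarrow> y \<otimes> x = k \<star> (x \<otimes> y)"

lemma commute_upto_mult_right:
  assumes "commute_upto k y x" "commute_upto l y x'"
    and [simp]: "x \<in> carrier E" "x' \<in> carrier E" "y \<in> carrier E"
  shows "commute_upto (k * l) y (x \<otimes> x')"
proof -
  have "y \<otimes> (x \<otimes> x') = (y \<otimes> x) \<otimes> x'"
    by (simp add: m_assoc)
  also have "\<dots> = k \<star> (x \<otimes> (y \<otimes> x'))"
    using assms(1) by (simp add: commute_upto_def m_assoc)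
  also have "\<dots> = (k * l) \<star> (x \<otimes> x' \<otimes> y)"
    using assms(2) by (simp add: commute_upto_def m_assoc)
  finally show ?thesis by (simp add: commute_upto_def)
qed

lemma commute_upto_mult_left:
  assumes "commute_upto k y x" "commute_upto l y' x"
    and [simp]: "x \<in> carrier E" "y \<in> carrier E" "y' \<in> carrier E"
  shows "commute_upto (k * l) (y \<otimes> y') x"
proof -
  have "y \<otimes> y' \<otimes> x = y \<otimes> (y' \<otimes> x)"
    by (simp add: m_assoc)
  also have "\<dots> = l \<star> ((y \<otimes> x) \<otimes> y')"
    using assms(2) by (simp add: commute_upto_def m_assoc)
  also have "\<dots> = (k * l) \<star> (x \<otimes> (y \<otimes> y'))"
    using assms(1) by (simp add: commute_upto_def m_assoc mult.commute)
  finally show ?thesis by (simp add: commute_upto_def)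
qed

lemma commute_upto_pow_right:
  assumes "commute_upto k y x" and [simp]: "x \<in> carrier E" "y \<in> carrier E"
  shows "commute_upto (k ^ n) y (x [^] (n::nat))"
proof (induction n)
  case 0
  show ?case by (simp add: commute_upto_def)
next
  case (Suc n)
  show ?case
    using commute_upto_mult_right[OF Suc assms(1)] by (simp add: mult.commute)
qed

lemma commute_upto_pow_left:
  assumes "commute_upto k y x" and [simp]: "x \<in> carrier E" "y \<in> carrier E"
  shows "commute_upto (k ^ n) (y [^] (n::nat)) x"
proof (induction n)
  case 0
  show ?case by (simp add: commute_upto_def)
next
  case (Suc n)
  show ?case
    using commute_upto_mult_left[OF Suc assms(1)] by (simp add: mult.commute)
qed

lemma commute_upto_pow_pow:
  assumes "commute_upto k y x" and [simp]: "x \<in> carrier E" "y \<in> carrier E"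
  shows "commute_upto (k ^ (n * m)) (y [^] (m::nat)) (x [^] (n::nat))"
  using commute_upto_pow_left[OF commute_upto_pow_right[OF assms]]
  by (simp add: power_mult)

text \<open>
  Collecting all \<open>z\<close> on the left moves the \<open>i\<close>-th of them past \<open>i - 1\<close> letters \<open>x\<close>, which gives
  \<open>0 + 1 + \<dots> + (n - 1)\<close> factors \<open>k\<close>.
\<close>

lemma pow_collect:
  assumes xz: "commute_upto k x z" and [simp]: "x \<in> carrier E" "z \<in> carrier E"
  shows "(z \<otimes> x) [^] n = k ^ (n choose 2) \<star> (z [^] n \<otimes> x [^] n)"
proof (induction n)
  case 0
  show ?case by (simp add: numeral_2_eq_2)
next
  case (Suc n)
  have "(z \<otimes> x) [^] Suc n = k ^ (n choose 2) \<star> (z [^] n \<otimes> (x [^] n \<otimes> z) \<otimes> x)"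
    by (simp add: Suc m_assoc)
  also have "x [^] n \<otimes> z = k ^ n \<star> (z \<otimes> x [^] n)"
    using commute_upto_pow_left[OF xz] by (simp add: commute_upto_def)
  finally show ?case
    by (simp add: m_assoc numeral_2_eq_2 flip: power_add) (simp add: add.commute)
qed

text \<open>
  By the relation \<open>y x = z x y\<close>, passing \<open>y\<close> through \<open>x\<^sup>n\<close> turns every \<open>x\<close> into \<open>z x\<close>.
\<close>

lemma pow_pass_left:
  assumes yx: "y \<otimes> x = z \<otimes> x \<otimes> y" and xz: "commute_upto k x z"
    and [simp]: "x \<in> carrier E" "y \<in> carrier E" "z \<in> carrier E"
  shows "y \<otimes> x [^] n = k ^ (n choose 2) \<star> (z [^] n \<otimes> x [^] n \<otimes> y)"
proof -
  have "y \<otimes> x [^] n = (z \<otimes> x) [^] n \<otimes> y"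
  proof (induction n)
    case (Suc n)
    have "y \<otimes> x [^] Suc n = (y \<otimes> x [^] n) \<otimes> x"
      by (simp add: m_assoc)
    also have "\<dots> = (z \<otimes> x) [^] n \<otimes> (y \<otimes> x)"
      by (simp add: Suc m_assoc)
    finally show ?case
      by (simp add: yx m_assoc)
  qed simp
  then show ?thesis
    by (simp add: pow_collect[OF xz])
qed

text \<open>
  Each of the \<open>b\<close> letters \<open>y\<close> creates a new \<open>z\<^sup>n\<close>, which the letters \<open>y\<close> to its left have to pass as well;
  the latter contributes \<open>n (0 + 1 + \<dots> + (b - 1))\<close> factors \<open>l\<close>.
\<close>

lemma pow_pass_pow:
  assumes yx: "y \<otimes> x = z \<otimes> x \<otimes> y" and xz: "commute_upto k x z" and yz: "commute_upto l y z"
    and [simp]: "x \<in> carrier E" "y \<in> carrier E" "z \<in> carrier E"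
  shows "y [^] b \<otimes> x [^] n =
    (k ^ (b * (n choose 2)) * l ^ (n * (b choose 2))) \<star> (z [^] (n * b) \<otimes> x [^] n \<otimes> y [^] b)"
proof (induction b)
  case 0
  show ?case by (simp add: numeral_2_eq_2)
next
  case (Suc b)
  have "y [^] Suc b \<otimes> x [^] n = y [^] b \<otimes> (y \<otimes> x [^] n)"
    by (simp add: m_assoc)
  also have "\<dots> = k ^ (n choose 2) \<star> ((y [^] b \<otimes> z [^] n) \<otimes> x [^] n \<otimes> y)"
    unfolding pow_pass_left[OF yx xz, simplified] by (simp add: m_assoc)
  also have "y [^] b \<otimes> z [^] n = l ^ (n * b) \<star> (z [^] n \<otimes> y [^] b)"
    using commute_upto_pow_pow[OF yz] by (simp add: commute_upto_def)
  also have "k ^ (n choose 2) \<star> (\<dots> \<otimes> x [^] n \<otimes> y)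
      = (k ^ (n choose 2) * l ^ (n * b)) \<star> (z [^] n \<otimes> (y [^] b \<otimes> x [^] n) \<otimes> y)"
    by (simp add: m_assoc)
  also have "\<dots> = (k ^ (n choose 2) * l ^ (n * b) * (k ^ (b * (n choose 2)) * l ^ (n * (b choose 2))))
      \<star> ((z [^] n \<otimes> z [^] (n * b)) \<otimes> x [^] n \<otimes> (y [^] b \<otimes> y))"
    unfolding Suc by (simp add: m_assoc)
  also have "z [^] n \<otimes> z [^] (n * b) = z [^] (n * Suc b)"
    by (simp add: nat_pow_mult)
  also have "k ^ (n choose 2) * l ^ (n * b) * (k ^ (b * (n choose 2)) * l ^ (n * (b choose 2)))
     = k ^ (Suc b * (n choose 2)) * l ^ (n * (Suc b choose 2))"
    by (simp add: numeral_2_eq_2 power_add algebra_simps)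
  finally show ?case by simp
qed

text \<open>
  The exponents of \<open>\<lambda>\<^sub>1\<close> and \<open>\<lambda>\<^sub>2\<close> in the theorem: \<open>z\<^bsup>c'\<^esup>\<close> passes \<open>x\<^sup>a y\<^sup>b\<close>, then \<open>y\<^sup>b\<close> passes \<open>x\<^bsup>a'\<^esup>\<close> by
  \<open>pow_pass_pow\<close>, and the letters \<open>z\<^bsup>a' b\<^esup>\<close> created in this way pass \<open>x\<^sup>a\<close>.
\<close>

lemma word_mult:
  assumes yx: "y \<otimes> x = z \<otimes> x \<otimes> y" and xz: "commute_upto k x z" and yz: "commute_upto l y z"
    and [simp]: "x \<in> carrier E" "y \<in> carrier E" "z \<in> carrier E"
  shows "word z x y c a b \<otimes> word z x y c' a' b' =
    (k ^ (c' * a + b * (a' choose 2) + a * b * a') * l ^ (c' * b + a' * (b choose 2)))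
      \<star> word z x y (c + c' + b * a') (a + a') (b + b')"
proof -
  let ?f = "k ^ (b * (a' choose 2)) * l ^ (a' * (b choose 2))"
  have 1: "y [^] b \<otimes> z [^] c' = l ^ (c' * b) \<star> (z [^] c' \<otimes> y [^] b)"
    using commute_upto_pow_pow[OF yz] by (simp add: commute_upto_def)
  have 2: "x [^] a \<otimes> z [^] n = k ^ (n * a) \<star> (z [^] n \<otimes> x [^] a)" for n
    using commute_upto_pow_pow[OF xz] by (simp add: commute_upto_def)
  have "word z x y c a b \<otimes> word z x y c' a' b'
    = z [^] c \<otimes> x [^] a \<otimes> (y [^] b \<otimes> z [^] c') \<otimes> x [^] a' \<otimes> y [^] b'"
    by (simp add: word_def m_assoc)
  also have "\<dots> = l ^ (c' * b) \<star> (z [^] c \<otimes> (x [^] a \<otimes> z [^] c') \<otimes> (y [^] b \<otimes> x [^] a') \<otimes> y [^] b')"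
    unfolding 1 by (simp add: m_assoc)
  also have "\<dots> = (l ^ (c' * b) * k ^ (c' * a) * ?f) \<star>
      (z [^] c \<otimes> z [^] c' \<otimes> (x [^] a \<otimes> z [^] (a' * b)) \<otimes> x [^] a' \<otimes> (y [^] b \<otimes> y [^] b'))"
    unfolding 2[of c'] pow_pass_pow[OF yx xz yz, simplified] by (simp add: m_assoc mult_ac)
  also have "\<dots> = (l ^ (c' * b) * k ^ (c' * a) * ?f * k ^ (a' * b * a)) \<star>
      ((z [^] c \<otimes> z [^] c' \<otimes> z [^] (a' * b)) \<otimes> (x [^] a \<otimes> x [^] a') \<otimes> (y [^] b \<otimes> y [^] b'))"
    unfolding 2 by (simp add: m_assoc mult_ac)
  also have "\<dots> = (l ^ (c' * b) * k ^ (c' * a) * ?f * k ^ (a' * b * a)) \<star>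
      word z x y (c + c' + b * a') (a + a') (b + b')"
    by (simp add: word_def nat_pow_mult mult.commute)
  also have "l ^ (c' * b) * k ^ (c' * a) * ?f * k ^ (a' * b * a)
    = k ^ (c' * a + b * (a' choose 2) + a * b * a') * l ^ (c' * b + a' * (b choose 2))"
    by (simp add: power_add mult_ac)
  finally show ?thesis .
qed

lemma word_commute:
  assumes x: "commute_upto l5 x2 x1" "commute_upto l7 x2 y1" "commute_upto 1 x2 z1"
    and y: "commute_upto l6 y2 x1" "commute_upto l8 y2 y1" "commute_upto 1 y2 z1"
    and z: "commute_upto 1 z2 x1" "commute_upto 1 z2 y1" "commute_upto 1 z2 z1"
    and [simp]: "x1 \<in> carrier E" "y1 \<in> carrier E" "z1 \<in> carrier E"
      "x2 \<in> carrier E" "y2 \<in> carrier E" "z2 \<in> carrier E"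
  shows "commute_upto (l5 ^ (a' * a) * l6 ^ (a' * b) * l7 ^ (b' * a) * l8 ^ (b' * b))
    (word z2 x2 y2 c a b) (word z1 x1 y1 c' a' b')"
proof -
  have word: "commute_upto (kz ^ (c' * m) * kx ^ (a' * m) * ky ^ (b' * m)) (w [^] m) (word z1 x1 y1 c' a' b')"
    if "commute_upto kx w x1" "commute_upto ky w y1" "commute_upto kz w z1" "w \<in> carrier E"
    for kx ky kz w and m :: nat
    unfolding word_def using that
    by (intro commute_upto_mult_right commute_upto_pow_pow) auto
  have "commute_upto (1 * (l5 ^ (a' * a) * l7 ^ (b' * a)) * (l6 ^ (a' * b) * l8 ^ (b' * b)))
      (word z2 x2 y2 c a b) (word z1 x1 y1 c' a' b')"
    unfolding word_def[of z2]
    using word[OF x, of a] word[OF y, of b] word[OF z, of c]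
    by (intro commute_upto_mult_left) auto
  then show ?thesis by (simp add: mult_ac)
qed

text \<open>
  Both sides of \<open>y x\<^sup>p = k\<^sup>p x\<^sup>p y\<close> are multiples of \<open>y\<close> if \<open>x\<^sup>p = 1\<close>.
\<close>

lemma commute_upto_pow_eq_one:
  assumes "commute_upto k y x" and "x [^] (p::nat) = \<one>"
    and free: "\<And>k. k \<star> y = y \<Longrightarrow> k = 1"
    and [simp]: "x \<in> carrier E" "y \<in> carrier E"
  shows "k ^ p = 1"
  using commute_upto_pow_right[OF assms(1), of p] assms(2) free[of "k ^ p"]
  by (simp add: commute_upto_def)

end

section \<open>Monomials of a twisted group algebra\<close>

lemma complex_nth_root_exists:
  assumes "n > 0" "w \<noteq> (0::complex)"
  obtains z where "z \<noteq> 0" "z ^ n = w"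
proof -
  have "card {z. z ^ n = w} > 0"
    using card_nth_roots[of w n] assms by simp
  then obtain z where "z ^ n = w"
    by (fastforce simp: card_gt_0_iff)
  then show thesis
    using assms that[of z] by (auto simp: zero_power)
qed

lemma odd_dvd_choose_two: "odd p \<Longrightarrow> p dvd (p choose 2)"
proof (elim oddE)
  fix b assume "p = 2 * b + 1"
  then have "p choose 2 = p * b" by (simp add: choose_two)
  then show ?thesis by simp
qed

locale twisted_group_algebra = monoid G for G (structure) +
  fixes \<alpha> :: "'a \<Rightarrow> 'a \<Rightarrow> complex"
  assumes cocycle: "two_cocycle G \<alpha>"
begin

text \<open>
  The multiples of \<open>0\<close> are kept so that all complex numbers act as scalars. The neutral element
  has to compensate for \<open>\<alpha>(1, 1)\<close>, which need not be 1.
\<close>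

definition monomials :: "(complex \<times> 'a) monoid" where
  "monomials = \<lparr>carrier = UNIV \<times> carrier G,
     monoid.mult = (\<lambda>(s, g) (t, h). (s * t * \<alpha> g h, g \<otimes> h)),
     one = (1 / \<alpha> \<one> \<one>, \<one>)\<rparr>"

definition scale :: "complex \<Rightarrow> complex \<times> 'a \<Rightarrow> complex \<times> 'a" where
  "scale k = apfst ((*) k)"

lemma cocycle_nonzero: "g \<in> carrier G \<Longrightarrow> h \<in> carrier G \<Longrightarrow> \<alpha> g h \<noteq> 0"
  using cocycle by (simp add: two_cocycle_def)

lemma cocycle_eq:
  "\<lbrakk>g \<in> carrier G; h \<in> carrier G; k \<in> carrier G\<rbrakk> \<Longrightarrow>
    \<alpha> g h * \<alpha> (g \<otimes> h) k = \<alpha> g (h \<otimes> k) * \<alpha> h k"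
  using cocycle by (simp add: two_cocycle_def)

lemma cocycle_one:
  assumes "g \<in> carrier G"
  shows "\<alpha> \<one> g = \<alpha> \<one> \<one>" "\<alpha> g \<one> = \<alpha> \<one> \<one>"
  using cocycle_eq[of \<one> \<one> g] cocycle_eq[of g \<one> \<one>] cocycle_nonzero[of \<one> g] cocycle_nonzero[of g \<one>] assms by auto

sublocale E: monoid_with_scalars monomials scale
proof
  fix x y z assume "x \<in> carrier monomials" "y \<in> carrier monomials" "z \<in> carrier monomials"
  then obtain s g t h u k where [simp]: "x = (s, g)" "y = (t, h)" "z = (u, k)"
    and [simp]: "g \<in> carrier G" "h \<in> carrier G" "k \<in> carrier G"
    by (auto simp: monomials_def)
  have "s * t * \<alpha> g h * u * \<alpha> (g \<otimes> h) k = s * t * u * (\<alpha> g h * \<alpha> (g \<otimes> h) k)"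
    by (simp only: mult_ac)
  also have "\<dots> = s * (t * u * \<alpha> h k) * \<alpha> g (h \<otimes> k)"
    by (simp only: cocycle_eq mult_ac \<open>g \<in> carrier G\<close> \<open>h \<in> carrier G\<close> \<open>k \<in> carrier G\<close>)
  finally show "x \<otimes>\<^bsub>monomials\<^esub> y \<otimes>\<^bsub>monomials\<^esub> z = x \<otimes>\<^bsub>monomials\<^esub> (y \<otimes>\<^bsub>monomials\<^esub> z)"
    by (simp add: monomials_def m_assoc)
next
  fix x assume "x \<in> carrier monomials"
  then obtain s g where "x = (s, g)" "g \<in> carrier G"
    by (auto simp: monomials_def)
  then show "\<one>\<^bsub>monomials\<^esub> \<otimes>\<^bsub>monomials\<^esub> x = x" "x \<otimes>\<^bsub>monomials\<^esub> \<one>\<^bsub>monomials\<^esub> = x"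
    using cocycle_one[of g] cocycle_nonzero[of \<one> \<one>] by (auto simp: monomials_def)
qed (auto simp: monomials_def scale_def)

lemma monomials_carrier [simp]: "u \<in> carrier monomials \<longleftrightarrow> snd u \<in> carrier G"
  by (cases u) (simp add: monomials_def)

lemma snd_mult [simp]: "snd (u \<otimes>\<^bsub>monomials\<^esub> v) = snd u \<otimes> snd v"
  by (cases u; cases v) (simp add: monomials_def)

lemma fst_mult: "fst (u \<otimes>\<^bsub>monomials\<^esub> v) = fst u * fst v * \<alpha> (snd u) (snd v)"
  by (cases u; cases v) (simp add: monomials_def)

lemma snd_one [simp]: "snd \<one>\<^bsub>monomials\<^esub> = \<one>"
  by (simp add: monomials_def)

lemma fst_one [simp]: "fst \<one>\<^bsub>monomials\<^esub> \<noteq> 0"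
  by (simp add: monomials_def cocycle_nonzero)

lemma snd_pow [simp]: "snd (u [^]\<^bsub>monomials\<^esub> (n::nat)) = snd u [^] n"
  by (induction n) simp_all

lemma fst_mult_nonzero [simp]:
  assumes "fst u \<noteq> 0" "fst v \<noteq> 0" "snd u \<in> carrier G" "snd v \<in> carrier G"
  shows "fst (u \<otimes>\<^bsub>monomials\<^esub> v) \<noteq> 0"
  using assms by (simp add: fst_mult cocycle_nonzero)

lemma fst_pow_nonzero [simp]:
  assumes "fst u \<noteq> 0" "snd u \<in> carrier G"
  shows "fst (u [^]\<^bsub>monomials\<^esub> (n::nat)) \<noteq> 0"
  using assms by (induction n) simp_all

lemma snd_scale [simp]: "snd (scale k u) = snd u"
  by (simp add: scale_def)

lemma fst_scale [simp]: "fst (scale k u) = k * fst u"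
  by (simp add: scale_def)

lemma scale_cancel: "fst u \<noteq> 0 \<Longrightarrow> scale k u = scale l u \<Longrightarrow> k = l"
  by (metis fst_scale mult_right_cancel)

lemma scale_eq_self: "fst u \<noteq> 0 \<Longrightarrow> scale k u = u \<Longrightarrow> k = 1"
  by (metis fst_scale mult_cancel_right1)

text \<open>
  An identity in \<open>G\<close> lifts to an identity of monomials up to a nonzero scalar.
\<close>

lemma same_snd_imp_scale:
  assumes "snd u = snd v" "fst u \<noteq> 0" "fst v \<noteq> 0"
  obtains k where "k \<noteq> 0" "u = scale k v"
  using assms by (intro that[of "fst u / fst v"]) (auto simp: prod_eq_iff)

text \<open>
  The \<open>p\<close>-th power of any lift is a scalar; dividing by a \<open>p\<close>-th root of it normalizes the lift.
\<close>

lemma lift_of_order: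
  assumes g: "g \<in> carrier G" "g [^] p = \<one>" and "(p::nat) > 0"
  obtains X where "snd X = g" "fst X \<noteq> 0" "X [^]\<^bsub>monomials\<^esub> p = \<one>\<^bsub>monomials\<^esub>"
proof -
  define X0 where "X0 = (1::complex, g)"
  have [simp]: "snd X0 = g" "fst X0 \<noteq> 0" by (simp_all add: X0_def)
  obtain t where t: "t \<noteq> 0" "\<one>\<^bsub>monomials\<^esub> = scale t (X0 [^]\<^bsub>monomials\<^esub> p)"
    by (rule same_snd_imp_scale[of "\<one>\<^bsub>monomials\<^esub>" "X0 [^]\<^bsub>monomials\<^esub> p"])
      (use g in auto)
  obtain r where r: "r \<noteq> 0" "r ^ p = t"
    using complex_nth_root_exists[OF \<open>p > 0\<close> t(1)] .
  show thesis
    by (rule that[of "scale r X0"]) (use g r t in \<open>auto simp: E.scal_pow\<close>)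
qed

lemma commute_upto_root_of_unity:
  assumes "snd Y \<otimes> snd X = snd X \<otimes> snd Y"
    and [simp]: "snd X \<in> carrier G" "snd Y \<in> carrier G" "fst X \<noteq> 0" "fst Y \<noteq> 0"
    and "X [^]\<^bsub>monomials\<^esub> (p::nat) = \<one>\<^bsub>monomials\<^esub>"
  obtains k where "k ^ p = 1" "k \<noteq> 0" "E.commute_upto k Y X"
proof -
  obtain k where k: "k \<noteq> 0" "Y \<otimes>\<^bsub>monomials\<^esub> X = scale k (X \<otimes>\<^bsub>monomials\<^esub> Y)"
    by (rule same_snd_imp_scale[of "Y \<otimes>\<^bsub>monomials\<^esub> X" "X \<otimes>\<^bsub>monomials\<^esub> Y"]) (use assms in auto)
  then have "E.commute_upto k Y X"
    by (simp add: E.commute_upto_def)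
  moreover from this have "k ^ p = 1"
    using E.commute_upto_pow_eq_one[of k Y X p] assms scale_eq_self by auto
  ultimately show thesis
    using k that by blast
qed

text \<open>
  \<open>W\<close> passes \<open>Y X\<close> with the scalar \<open>k l\<close> and passes \<open>Z X Y\<close>, which is the same element, with \<open>m k l\<close>,
  where \<open>m\<close> is the scalar for \<open>Z\<close>. So \<open>m = 1\<close>.
\<close>

lemma commute_with_commutator:
  assumes YX: "Y \<otimes>\<^bsub>monomials\<^esub> X = Z \<otimes>\<^bsub>monomials\<^esub> X \<otimes>\<^bsub>monomials\<^esub> Y"
    and k: "E.commute_upto k W X" "k \<noteq> 0" and l: "E.commute_upto l W Y" "l \<noteq> 0"
    and WZ: "snd W \<otimes> snd Z = snd Z \<otimes> snd W"
    and [simp]: "snd X \<in> carrier G" "snd Y \<in> carrier G" "snd Z \<in> carrier G" "snd W \<in> carrier G"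
      "fst X \<noteq> 0" "fst Y \<noteq> 0" "fst Z \<noteq> 0" "fst W \<noteq> 0"
  shows "E.commute_upto 1 W Z"
proof -
  obtain m where "m \<noteq> 0" and "W \<otimes>\<^bsub>monomials\<^esub> Z = scale m (Z \<otimes>\<^bsub>monomials\<^esub> W)"
    by (rule same_snd_imp_scale[of "W \<otimes>\<^bsub>monomials\<^esub> Z" "Z \<otimes>\<^bsub>monomials\<^esub> W"]) (use WZ in auto)
  then have m: "E.commute_upto m W Z"
    by (simp add: E.commute_upto_def)
  have "E.commute_upto (l * k) W (Y \<otimes>\<^bsub>monomials\<^esub> X)"
    by (intro E.commute_upto_mult_right k l) auto
  moreover have "E.commute_upto (m * k * l) W (Y \<otimes>\<^bsub>monomials\<^esub> X)"
    unfolding YX by (intro E.commute_upto_mult_right k l m) auto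
  ultimately have "l * k = m * k * l"
    unfolding E.commute_upto_def
    by (intro scale_cancel[of "Y \<otimes>\<^bsub>monomials\<^esub> X \<otimes>\<^bsub>monomials\<^esub> W"]) auto
  with k l have "m = 1" by simp
  with m show ?thesis by simp
qed

text \<open>
  The relations of a Heisenberg group modulo \<open>p\<close> lift, except that \<open>Z\<close> is central only up to \<open>p\<close>-th
  roots of unity. That \<open>Z\<^sup>p = 1\<close> cannot be arranged by rescaling, as \<open>Z\<close> is determined by \<open>X\<close> and \<open>Y\<close>;
  it is where \<open>p\<close> has to be odd.
\<close>

lemma heisenberg_lift:
  assumes g: "gx \<in> carrier G" "gy \<in> carrier G" "gz \<in> carrier G"
    and rel: "gy \<otimes> gx = gz \<otimes> gx \<otimes> gy" "gx \<otimes> gz = gz \<otimes> gx" "gy \<otimes> gz = gz \<otimes> gy"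
    and pow: "gx [^] p = \<one>" "gy [^] p = \<one>" "gz [^] p = \<one>" and "odd (p::nat)"
  obtains X Y Z k l where "snd X = gx" "snd Y = gy" "snd Z = gz" "fst X \<noteq> 0" "fst Y \<noteq> 0" "fst Z \<noteq> 0"
    "X [^]\<^bsub>monomials\<^esub> p = \<one>\<^bsub>monomials\<^esub>" "Y [^]\<^bsub>monomials\<^esub> p = \<one>\<^bsub>monomials\<^esub>"
    "Z [^]\<^bsub>monomials\<^esub> p = \<one>\<^bsub>monomials\<^esub>"
    "Y \<otimes>\<^bsub>monomials\<^esub> X = Z \<otimes>\<^bsub>monomials\<^esub> X \<otimes>\<^bsub>monomials\<^esub> Y"
    "E.commute_upto k X Z" "E.commute_upto l Y Z" "k ^ p = 1" "l ^ p = 1" "k \<noteq> 0" "l \<noteq> 0"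
proof -
  have "p > 0" using \<open>odd p\<close> by (simp add: odd_pos)
  obtain X where X: "snd X = gx" "fst X \<noteq> 0" "X [^]\<^bsub>monomials\<^esub> p = \<one>\<^bsub>monomials\<^esub>"
    using lift_of_order[OF g(1) pow(1) \<open>p > 0\<close>] .
  obtain Y where Y: "snd Y = gy" "fst Y \<noteq> 0" "Y [^]\<^bsub>monomials\<^esub> p = \<one>\<^bsub>monomials\<^esub>"
    using lift_of_order[OF g(2) pow(2) \<open>p > 0\<close>] .
  define Z0 where "Z0 = (1::complex, gz)"
  obtain t where t: "t \<noteq> 0"
    "Y \<otimes>\<^bsub>monomials\<^esub> X = scale t (Z0 \<otimes>\<^bsub>monomials\<^esub> X \<otimes>\<^bsub>monomials\<^esub> Y)"
    by (rule same_snd_imp_scale[of "Y \<otimes>\<^bsub>monomials\<^esub> X" "Z0 \<otimes>\<^bsub>monomials\<^esub> X \<otimes>\<^bsub>monomials\<^esub> Y"])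
      (use g rel X Y in \<open>auto simp: Z0_def\<close>)
  define Z where "Z = scale t Z0"
  have Z: "snd Z = gz" "fst Z \<noteq> 0"
    using t by (auto simp: Z_def Z0_def)
  have YX: "Y \<otimes>\<^bsub>monomials\<^esub> X = Z \<otimes>\<^bsub>monomials\<^esub> X \<otimes>\<^bsub>monomials\<^esub> Y"
    using t g X Y by (simp add: Z_def Z0_def)
  note [simp] = X Y Z g
  obtain k' where k': "k' ^ p = 1" "k' \<noteq> 0" "E.commute_upto k' Z X"
    by (rule commute_upto_root_of_unity[of Z X p]) (use rel in auto)
  obtain l' where l': "l' ^ p = 1" "l' \<noteq> 0" "E.commute_upto l' Z Y"
    by (rule commute_upto_root_of_unity[of Z Y p]) (use rel in auto)
  have XZ: "E.commute_upto (1 / k') X Z" and YZ: "E.commute_upto (1 / l') Y Z"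
    using k' l' by (simp_all add: E.commute_upto_def)
  have kp: "(1 / k') ^ p = 1" and lp: "(1 / l') ^ p = 1"
    using k' l' by (simp_all add: power_divide)
  have kC: "(1 / k') ^ (p choose 2) = 1"
    using odd_dvd_choose_two[OF \<open>odd p\<close>] kp by (metis dvd_def power_mult power_one)
  obtain s where s: "Z [^]\<^bsub>monomials\<^esub> p = scale s \<one>\<^bsub>monomials\<^esub>"
    by (rule same_snd_imp_scale[of "Z [^]\<^bsub>monomials\<^esub> p" "\<one>\<^bsub>monomials\<^esub>"]) (use pow in auto)
  \<comment> \<open>In \<open>Y X\<^sup>p = (1 / k')\<^bsup>p choose 2\<^esup> Z\<^sup>p X\<^sup>p Y\<close> everything except \<open>Z\<^sup>p = s\<close> is already known to be trivial.\<close>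
  have "scale s Y = Y"
    using E.pow_pass_left[OF YX XZ, of p] kC s by simp
  then have "s = 1"
    using scale_eq_self[of Y s] by simp
  then have "Z [^]\<^bsub>monomials\<^esub> p = \<one>\<^bsub>monomials\<^esub>"
    using s by simp
  then show thesis
    using that[of X Y Z "1 / k'" "1 / l'"] XZ YZ kp lp YX k' l' by simp
qed

text \<open>
  The word \<open>g\<close> in the generators has the lift \<open>W\<close>, the same word in the lifted generators, and \<open>\<nu>\<close> is the
  scalar of \<open>W\<close> as a multiple of \<open>g\<close>. Thus \<open>1 / \<nu>\<close> is the cochain that relates \<open>\<alpha>\<close> to the normal form. The
  period \<open>p\<close> of \<open>\<nu>\<close> in each argument makes it a function of exponents modulo \<open>p\<close>.
\<close>

theorem cocycle_normal_form:
  assumes x1: "x1 \<in> carrier G" "x1 [^] p = \<one>" and y1: "y1 \<in> carrier G" "y1 [^] p = \<one>"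
    and z1: "z1 \<in> carrier G" "z1 [^] p = \<one>"
    and x2: "x2 \<in> carrier G" "x2 [^] p = \<one>" and y2: "y2 \<in> carrier G" "y2 [^] p = \<one>"
    and z2: "z2 \<in> carrier G" "z2 [^] p = \<one>"
    and rel1: "y1 \<otimes> x1 = z1 \<otimes> x1 \<otimes> y1" "x1 \<otimes> z1 = z1 \<otimes> x1" "y1 \<otimes> z1 = z1 \<otimes> y1"
    and rel2: "y2 \<otimes> x2 = z2 \<otimes> x2 \<otimes> y2" "x2 \<otimes> z2 = z2 \<otimes> x2" "y2 \<otimes> z2 = z2 \<otimes> y2"
    and comm: "\<And>u v. u \<in> {x1, y1, z1} \<Longrightarrow> v \<in> {x2, y2, z2} \<Longrightarrow> v \<otimes> u = u \<otimes> v"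
    and "odd p"
  defines "g \<equiv> \<lambda>a1 a2 b1 b2 c1 c2. word z1 x1 y1 c1 a1 b1 \<otimes> word z2 x2 y2 c2 a2 b2"
  obtains \<nu> :: "nat \<Rightarrow> nat \<Rightarrow> nat \<Rightarrow> nat \<Rightarrow> nat \<Rightarrow> nat \<Rightarrow> complex" and l1 l2 l3 l4 l5 l6 l7 l8
  where "\<And>l. l \<in> {l1, l2, l3, l4, l5, l6, l7, l8} \<Longrightarrow> l \<noteq> 0 \<and> l ^ p = 1"
    and "\<And>a1 a2 b1 b2 c1 c2. \<nu> a1 a2 b1 b2 c1 c2 \<noteq> 0"
    and "\<And>a1 a2 b1 b2 c1 c2. \<nu> a1 a2 b1 b2 c1 c2 =
      \<nu> (a1 mod p) (a2 mod p) (b1 mod p) (b2 mod p) (c1 mod p) (c2 mod p)"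
    and "\<And>a1 a2 b1 b2 c1 c2 a1' a2' b1' b2' c1' c2'.
      \<nu> a1 a2 b1 b2 c1 c2 * \<nu> a1' a2' b1' b2' c1' c2' *
        \<alpha> (g a1 a2 b1 b2 c1 c2) (g a1' a2' b1' b2' c1' c2') =
      l1 ^ (c1' * a1 + b1 * (a1' choose 2) + a1 * b1 * a1') * l2 ^ (c1' * b1 + a1' * (b1 choose 2)) *
      l3 ^ (c2' * a2 + b2 * (a2' choose 2) + a2 * b2 * a2') * l4 ^ (c2' * b2 + a2' * (b2 choose 2)) *
      l5 ^ (a1' * a2) * l6 ^ (a1' * b2) * l7 ^ (b1' * a2) * l8 ^ (b1' * b2) *
      \<nu> (a1 + a1') (a2 + a2') (b1 + b1') (b2 + b2') (c1 + c1' + b1 * a1') (c2 + c2' + b2 * a2')"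
proof -
  have "p > 0" using \<open>odd p\<close> by (simp add: odd_pos)
  obtain X1 Y1 Z1 l1 l2 where one: "snd X1 = x1" "snd Y1 = y1" "snd Z1 = z1"
    "fst X1 \<noteq> 0" "fst Y1 \<noteq> 0" "fst Z1 \<noteq> 0"
    "X1 [^]\<^bsub>monomials\<^esub> p = \<one>\<^bsub>monomials\<^esub>" "Y1 [^]\<^bsub>monomials\<^esub> p = \<one>\<^bsub>monomials\<^esub>"
    "Z1 [^]\<^bsub>monomials\<^esub> p = \<one>\<^bsub>monomials\<^esub>"
    and YX1: "Y1 \<otimes>\<^bsub>monomials\<^esub> X1 = Z1 \<otimes>\<^bsub>monomials\<^esub> X1 \<otimes>\<^bsub>monomials\<^esub> Y1"
    and XZ1: "E.commute_upto l1 X1 Z1" and YZ1: "E.commute_upto l2 Y1 Z1"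
    and l12: "l1 ^ p = 1" "l2 ^ p = 1" "l1 \<noteq> 0" "l2 \<noteq> 0"
    using heisenberg_lift[OF x1(1) y1(1) z1(1) rel1 x1(2) y1(2) z1(2) \<open>odd p\<close>] .
  obtain X2 Y2 Z2 l3 l4 where two: "snd X2 = x2" "snd Y2 = y2" "snd Z2 = z2"
    "fst X2 \<noteq> 0" "fst Y2 \<noteq> 0" "fst Z2 \<noteq> 0"
    "X2 [^]\<^bsub>monomials\<^esub> p = \<one>\<^bsub>monomials\<^esub>" "Y2 [^]\<^bsub>monomials\<^esub> p = \<one>\<^bsub>monomials\<^esub>"
    "Z2 [^]\<^bsub>monomials\<^esub> p = \<one>\<^bsub>monomials\<^esub>"
    and YX2: "Y2 \<otimes>\<^bsub>monomials\<^esub> X2 = Z2 \<otimes>\<^bsub>monomials\<^esub> X2 \<otimes>\<^bsub>monomials\<^esub> Y2"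
    and XZ2: "E.commute_upto l3 X2 Z2" and YZ2: "E.commute_upto l4 Y2 Z2"
    and l34: "l3 ^ p = 1" "l4 ^ p = 1" "l3 \<noteq> 0" "l4 \<noteq> 0"
    using heisenberg_lift[OF x2(1) y2(1) z2(1) rel2 x2(2) y2(2) z2(2) \<open>odd p\<close>] .
  note [simp] = one two x1 y1 z1 x2 y2 z2
  have ex: "\<exists>k. k ^ p = 1 \<and> k \<noteq> 0 \<and> E.commute_upto k V U"
    if "U \<in> {X1, Y1}" "V \<in> {X2, Y2}" for U V
    by (rule commute_upto_root_of_unity[of V U p]) (use that in \<open>auto intro: comm\<close>)
  obtain l5 l6 l7 l8 where l58: "l5 ^ p = 1" "l6 ^ p = 1" "l7 ^ p = 1" "l8 ^ p = 1"
      "l5 \<noteq> 0" "l6 \<noteq> 0" "l7 \<noteq> 0" "l8 \<noteq> 0"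
    and XX: "E.commute_upto l5 X2 X1" and YX: "E.commute_upto l6 Y2 X1"
    and XY: "E.commute_upto l7 X2 Y1" and YY: "E.commute_upto l8 Y2 Y1"
    using ex[of X1 X2] ex[of X1 Y2] ex[of Y1 X2] ex[of Y1 Y2] by auto
  have XZ: "E.commute_upto 1 X2 Z1"
    by (rule commute_with_commutator[OF YX1 XX _ XY]) (auto simp: l58 intro: comm comm[symmetric])
  have YZ: "E.commute_upto 1 Y2 Z1"
    by (rule commute_with_commutator[OF YX1 YX _ YY]) (auto simp: l58 intro: comm comm[symmetric])
  have inverse: "E.commute_upto (1 / k) U V"
    if "E.commute_upto k V U" "k \<noteq> 0" "snd U \<in> carrier G" "snd V \<in> carrier G" for k U V
    using that by (simp add: E.commute_upto_def)
  \<comment> \<open>\<open>Z2\<close> is the commutator now, so it is the element passed; the scalars are inverted because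
    \<open>X1\<close> and \<open>Y1\<close> move through \<open>X2\<close> and \<open>Y2\<close> in the opposite direction.\<close>
  have "E.commute_upto 1 X1 Z2"
    by (rule commute_with_commutator[OF YX2 inverse[OF XX] _ inverse[OF YX]])
      (auto simp: l58 intro: comm comm[symmetric])
  then have ZX: "E.commute_upto 1 Z2 X1"
    using inverse[of 1 X1 Z2] by simp
  have "E.commute_upto 1 Y1 Z2"
    by (rule commute_with_commutator[OF YX2 inverse[OF XY] _ inverse[OF YY]])
      (auto simp: l58 intro: comm comm[symmetric])
  then have ZY: "E.commute_upto 1 Z2 Y1"
    using inverse[of 1 Y1 Z2] by simp
  have ZZ: "E.commute_upto 1 Z2 Z1"
    by (rule commute_with_commutator[OF YX1 ZX _ ZY]) (auto intro: comm)
  define U1 where "U1 = (\<lambda>a b c. E.word Z1 X1 Y1 c a b)"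
  define U2 where "U2 = (\<lambda>a b c. E.word Z2 X2 Y2 c a b)"
  define W where "W = (\<lambda>a1 a2 b1 b2 c1 c2. U1 a1 b1 c1 \<otimes>\<^bsub>monomials\<^esub> U2 a2 b2 c2)"
  have snd_U: "snd (U1 a b c) = word z1 x1 y1 c a b" "snd (U2 a b c) = word z2 x2 y2 c a b" for a b c
    by (simp_all add: U1_def U2_def E.word_def word_def)
  have fst_U: "fst (U1 a b c) \<noteq> 0" "fst (U2 a b c) \<noteq> 0" for a b c
    by (simp_all add: U1_def U2_def E.word_def)
  have snd_W: "snd (W a1 a2 b1 b2 c1 c2) = g a1 a2 b1 b2 c1 c2" for a1 a2 b1 b2 c1 c2
    by (simp add: W_def g_def snd_U)
  have pow_mod: "u [^]\<^bsub>monomials\<^esub> n = u [^]\<^bsub>monomials\<^esub> (n mod p)"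
    if "u \<in> {X1, Y1, Z1, X2, Y2, Z2}" for u n
  proof -
    have u: "snd u \<in> carrier G" "u [^]\<^bsub>monomials\<^esub> p = \<one>\<^bsub>monomials\<^esub>"
      using that by auto
    have "u [^]\<^bsub>monomials\<^esub> n = u [^]\<^bsub>monomials\<^esub> (p * (n div p) + n mod p)"
      by simp
    also have "\<dots> = (u [^]\<^bsub>monomials\<^esub> p) [^]\<^bsub>monomials\<^esub> (n div p) \<otimes>\<^bsub>monomials\<^esub> u [^]\<^bsub>monomials\<^esub> (n mod p)"
      using u(1) by (simp add: E.nat_pow_pow E.nat_pow_mult)
    finally show ?thesis
      using u by simp
  qed
  have U_mod: "U1 a b c = U1 (a mod p) (b mod p) (c mod p)" "U2 a b c = U2 (a mod p) (b mod p) (c mod p)"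
    for a b c
    unfolding U1_def U2_def E.word_def
    using pow_mod[of X1 a] pow_mod[of Y1 b] pow_mod[of Z1 c]
      pow_mod[of X2 a] pow_mod[of Y2 b] pow_mod[of Z2 c] by simp_all
  have W_mult: "W a1 a2 b1 b2 c1 c2 \<otimes>\<^bsub>monomials\<^esub> W a1' a2' b1' b2' c1' c2' = scale
     (l1 ^ (c1' * a1 + b1 * (a1' choose 2) + a1 * b1 * a1') * l2 ^ (c1' * b1 + a1' * (b1 choose 2)) *
      l3 ^ (c2' * a2 + b2 * (a2' choose 2) + a2 * b2 * a2') * l4 ^ (c2' * b2 + a2' * (b2 choose 2)) *
      l5 ^ (a1' * a2) * l6 ^ (a1' * b2) * l7 ^ (b1' * a2) * l8 ^ (b1' * b2))
     (W (a1 + a1') (a2 + a2') (b1 + b1') (b2 + b2') (c1 + c1' + b1 * a1') (c2 + c2' + b2 * a2'))"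
    (is "_ = scale ?k ?W")
    for a1 a2 b1 b2 c1 c2 a1' a2' b1' b2' c1' c2'
  proof -
    let ?U1 = "U1 a1 b1 c1" and ?U2 = "U2 a2 b2 c2" and ?U1' = "U1 a1' b1' c1'" and ?U2' = "U2 a2' b2' c2'"
    let ?cross = "l5 ^ (a1' * a2) * l6 ^ (a1' * b2) * l7 ^ (b1' * a2) * l8 ^ (b1' * b2)"
    have [simp]: "snd ?U1 \<in> carrier G" "snd ?U2 \<in> carrier G" "snd ?U1' \<in> carrier G" "snd ?U2' \<in> carrier G"
      by (simp_all add: snd_U)
    have U21: "?U2 \<otimes>\<^bsub>monomials\<^esub> ?U1' = scale ?cross (?U1' \<otimes>\<^bsub>monomials\<^esub> ?U2)"
      using E.word_commute[OF XX XY XZ YX YY YZ ZX ZY ZZ]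
      by (simp add: E.commute_upto_def U1_def U2_def)
    have U11: "?U1 \<otimes>\<^bsub>monomials\<^esub> ?U1' = scale
        (l1 ^ (c1' * a1 + b1 * (a1' choose 2) + a1 * b1 * a1') * l2 ^ (c1' * b1 + a1' * (b1 choose 2)))
        (U1 (a1 + a1') (b1 + b1') (c1 + c1' + b1 * a1'))"
      using E.word_mult[OF YX1 XZ1 YZ1] by (simp add: U1_def)
    have U22: "?U2 \<otimes>\<^bsub>monomials\<^esub> ?U2' = scale
        (l3 ^ (c2' * a2 + b2 * (a2' choose 2) + a2 * b2 * a2') * l4 ^ (c2' * b2 + a2' * (b2 choose 2)))
        (U2 (a2 + a2') (b2 + b2') (c2 + c2' + b2 * a2'))"
      using E.word_mult[OF YX2 XZ2 YZ2] by (simp add: U2_def)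
    have "W a1 a2 b1 b2 c1 c2 \<otimes>\<^bsub>monomials\<^esub> W a1' a2' b1' b2' c1' c2' =
        ?U1 \<otimes>\<^bsub>monomials\<^esub> (?U2 \<otimes>\<^bsub>monomials\<^esub> ?U1') \<otimes>\<^bsub>monomials\<^esub> ?U2'"
      by (simp add: W_def E.m_assoc)
    also have "\<dots> = scale ?cross ((?U1 \<otimes>\<^bsub>monomials\<^esub> ?U1') \<otimes>\<^bsub>monomials\<^esub> (?U2 \<otimes>\<^bsub>monomials\<^esub> ?U2'))"
      unfolding U21 by (simp add: E.m_assoc)
    also have "\<dots> = scale ?k ?W"
      unfolding U11 U22 by (simp add: W_def snd_U mult_ac)
    finally show ?thesis .
  qed
  show thesis
  proof (rule that[of l1 l2 l3 l4 l5 l6 l7 l8 "\<lambda>a1 a2 b1 b2 c1 c2. fst (W a1 a2 b1 b2 c1 c2)"])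
    show "l \<noteq> 0 \<and> l ^ p = 1" if "l \<in> {l1, l2, l3, l4, l5, l6, l7, l8}" for l
      using that l12 l34 l58 by auto
    show "fst (W a1 a2 b1 b2 c1 c2) \<noteq> 0" for a1 a2 b1 b2 c1 c2
      by (simp add: W_def fst_U snd_U)
    show "fst (W a1 a2 b1 b2 c1 c2) =
        fst (W (a1 mod p) (a2 mod p) (b1 mod p) (b2 mod p) (c1 mod p) (c2 mod p))" for a1 a2 b1 b2 c1 c2
      unfolding W_def using U_mod by metis
    show "fst (W a1 a2 b1 b2 c1 c2) * fst (W a1' a2' b1' b2' c1' c2') *
        \<alpha> (g a1 a2 b1 b2 c1 c2) (g a1' a2' b1' b2' c1' c2') =
      l1 ^ (c1' * a1 + b1 * (a1' choose 2) + a1 * b1 * a1') * l2 ^ (c1' * b1 + a1' * (b1 choose 2)) *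
      l3 ^ (c2' * a2 + b2 * (a2' choose 2) + a2 * b2 * a2') * l4 ^ (c2' * b2 + a2' * (b2 choose 2)) *
      l5 ^ (a1' * a2) * l6 ^ (a1' * b2) * l7 ^ (b1' * a2) * l8 ^ (b1' * b2) *
      fst (W (a1 + a1') (a2 + a2') (b1 + b1') (b2 + b2') (c1 + c1' + b1 * a1') (c2 + c2' + b2 * a2'))"
      for a1 a2 b1 b2 c1 c2 a1' a2' b1' b2' c1' c2'
      using arg_cong[OF W_mult[of a1 a2 b1 b2 c1 c2 a1' a2' b1' b2' c1' c2'], of fst]
      unfolding fst_mult fst_scale snd_W .
  qed
qed

end

section \<open>Unitriangular matrices over a ring\<close>

definition unitri :: "('a, 'm) ring_scheme \<Rightarrow> 'a \<Rightarrow> 'a \<Rightarrow> 'a \<Rightarrow> 'a mat" where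
  "unitri R a b c = mat_of_rows_list 3
     [[\<one>\<^bsub>R\<^esub>, b, c], [\<zero>\<^bsub>R\<^esub>, \<one>\<^bsub>R\<^esub>, a], [\<zero>\<^bsub>R\<^esub>, \<zero>\<^bsub>R\<^esub>, \<one>\<^bsub>R\<^esub>]]"

lemma unitri_carrier [simp]: "unitri R a b c \<in> carrier_mat 3 3"
  by (rule carrier_matI) (simp_all add: unitri_def mat_of_rows_list_def)

lemma unitri_entries [simp]:
  "unitri R a b c $$ (0, 0) = \<one>\<^bsub>R\<^esub>" "unitri R a b c $$ (0, Suc 0) = b" "unitri R a b c $$ (0, 2) = c"
  "unitri R a b c $$ (Suc 0, 0) = \<zero>\<^bsub>R\<^esub>" "unitri R a b c $$ (Suc 0, Suc 0) = \<one>\<^bsub>R\<^esub>"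
  "unitri R a b c $$ (Suc 0, 2) = a"
  "unitri R a b c $$ (2, 0) = \<zero>\<^bsub>R\<^esub>" "unitri R a b c $$ (2, Suc 0) = \<zero>\<^bsub>R\<^esub>" "unitri R a b c $$ (2, 2) = \<one>\<^bsub>R\<^esub>"
  by (simp_all add: unitri_def mat_of_rows_list_def)

lemma all_less_3: "(\<forall>i<3. P i) \<longleftrightarrow> P 0 \<and> P (Suc 0) \<and> P (2::nat)"
  by (auto simp: numeral_3_eq_3 numeral_2_eq_2 less_Suc_eq)

lemma mat3_eqI:
  assumes "A \<in> carrier_mat 3 3" "B \<in> carrier_mat 3 3" "\<forall>i<3. \<forall>j<3. A $$ (i, j) = B $$ (i, j)"
  shows "A = B"
  by (rule eq_matI) (use assms in auto)

context ring
begin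

lemma H3_carrier: "carrier (H3 R) = {unitri R a b c |a b c. a \<in> carrier R \<and> b \<in> carrier R \<and> c \<in> carrier R}"
proof (intro equalityI subsetI)
  fix A assume "A \<in> carrier (H3 R)"
  then have A: "A \<in> carrier_mat 3 3" "\<forall>i<3. \<forall>j<3. A $$ (i, j) \<in> carrier R"
    "\<forall>i<3. A $$ (i, i) = \<one>" "\<forall>i<3. \<forall>j<i. A $$ (i, j) = \<zero>"
    by (auto simp: H3_def unitriangular3_def)
  have "A = unitri R (A $$ (1, 2)) (A $$ (0, 1)) (A $$ (0, 2))"
    by (rule mat3_eqI[OF A(1)]) (use A(3,4) in \<open>simp_all add: all_less_3\<close>)
  then show "A \<in> {unitri R a b c |a b c. a \<in> carrier R \<and> b \<in> carrier R \<and> c \<in> carrier R}"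
    using A(2) by (auto simp: all_less_3)
next
  fix A assume "A \<in> {unitri R a b c |a b c. a \<in> carrier R \<and> b \<in> carrier R \<and> c \<in> carrier R}"
  then obtain a b c where A: "A = unitri R a b c" "a \<in> carrier R" "b \<in> carrier R" "c \<in> carrier R"
    by blast
  have "\<forall>j<i. unitri R a b c $$ (i, j) = \<zero>" if "i < 3" for i
  proof -
    have "i = 0 \<or> i = Suc 0 \<or> i = 2"
      using that by linarith
    then show ?thesis
      by (auto simp: less_Suc_eq numeral_2_eq_2 simp del: unitri_entries)
        (simp_all add: unitri_def mat_of_rows_list_def)
  qed
  then show "A \<in> carrier (H3 R)"
    using A by (simp add: H3_def unitriangular3_def all_less_3)
qed

lemma H3_one: "\<one>\<^bsub>H3 R\<^esub> = unitri R \<zero> \<zero> \<zero>"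
  by (rule mat3_eqI) (simp_all add: H3_def all_less_3)

lemma H3_mult:
  assumes [simp]: "a \<in> carrier R" "b \<in> carrier R" "c \<in> carrier R"
    "a' \<in> carrier R" "b' \<in> carrier R" "c' \<in> carrier R"
  shows "unitri R a b c \<otimes>\<^bsub>H3 R\<^esub> unitri R a' b' c' = unitri R (a \<oplus> a') (b \<oplus> b') (c \<oplus> c' \<oplus> b \<otimes> a')"
proof -
  have "{..<3::nat} = {0, Suc 0, 2}" by (auto simp: numeral_3_eq_3 less_Suc_eq)
  then show ?thesis
    by (intro mat3_eqI) (simp_all add: H3_def all_less_3 Pi_iff a_ac)
qed

end

section \<open>The group over pairs of residue classes\<close>

text \<open>
  Integer coordinates, reduced on entry, so that the group law below is polynomial without any
  reductions.
\<close>

definition heis :: "int \<Rightarrow> int \<Rightarrow> int \<Rightarrow> int \<Rightarrow> int \<Rightarrow> int \<Rightarrow> int \<Rightarrow> (int \<times> int) mat" where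
  "heis m a1 a2 b1 b2 c1 c2 =
    H3_elem (residue_ring m) (a1 mod m) (a2 mod m) (b1 mod m) (b2 mod m) (c1 mod m) (c2 mod m)"

abbreviation Heis_sq :: "int \<Rightarrow> (int \<times> int) mat monoid" where
  "Heis_sq m \<equiv> H3 (RDirProd (residue_ring m) (residue_ring m))"

lemmas RDirProd_ops = RDirProd_def DirProd_def monoid.defs

lemma H3_elem_eq_unitri: "H3_elem S a1 a2 b1 b2 c1 c2 = unitri (RDirProd S S) (a1, a2) (b1, b2) (c1, c2)"
  by (simp add: H3_elem_def unitri_def Let_def)

context residues
begin

lemma ring_RDirProd: "ring (RDirProd R R)"
  by (intro RDirProd_ring cring.axioms(1) cring)

lemma heis_mult:
  "heis m a1 a2 b1 b2 c1 c2 \<otimes>\<^bsub>Heis_sq m\<^esub> heis m a1' a2' b1' b2' c1' c2' =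
    heis m (a1 + a1') (a2 + a2') (b1 + b1') (b2 + b2') (c1 + c1' + b1 * a1') (c2 + c2' + b2 * a2')"
  using m_gt_one unfolding heis_def H3_elem_eq_unitri
  by (subst ring.H3_mult[OF ring_RDirProd[unfolded R_m_def]])
    (simp_all add: RDirProd_ops residue_ring_def mod_simps)

lemma heis_one: "\<one>\<^bsub>Heis_sq m\<^esub> = heis m 0 0 0 0 0 0"
  unfolding heis_def H3_elem_eq_unitri ring.H3_one[OF ring_RDirProd[unfolded R_m_def]]
  by (simp add: RDirProd_ops residue_ring_def)

lemma heis_closed [simp]: "heis m a1 a2 b1 b2 c1 c2 \<in> carrier (Heis_sq m)"
  unfolding heis_def H3_elem_eq_unitri ring.H3_carrier[OF ring_RDirProd[unfolded R_m_def]]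
  by (rule CollectI, intro exI conjI, rule refl) (use m_gt_one in \<open>simp_all add: RDirProd_carrier residue_ring_def\<close>)

lemma heis_cases:
  assumes "g \<in> carrier (Heis_sq m)"
  obtains a1 a2 b1 b2 c1 c2 where "g = heis m a1 a2 b1 b2 c1 c2"
proof -
  from assms obtain a1 a2 b1 b2 c1 c2 where "g = H3_elem (residue_ring m) a1 a2 b1 b2 c1 c2"
    "{a1, a2, b1, b2, c1, c2} \<subseteq> {0..m - 1}"
    unfolding H3_elem_eq_unitri ring.H3_carrier[OF ring_RDirProd[unfolded R_m_def]]
    by (auto simp: RDirProd_ops residue_ring_def)
  then have "g = heis m a1 a2 b1 b2 c1 c2"
    by (simp add: heis_def)
  then show thesis ..
qed

lemma monoid_Heis_sq: "monoid (Heis_sq m)"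
proof (rule monoidI)
  fix x y z assume "x \<in> carrier (Heis_sq m)" "y \<in> carrier (Heis_sq m)" "z \<in> carrier (Heis_sq m)"
  then show "x \<otimes>\<^bsub>Heis_sq m\<^esub> y \<otimes>\<^bsub>Heis_sq m\<^esub> z = x \<otimes>\<^bsub>Heis_sq m\<^esub> (y \<otimes>\<^bsub>Heis_sq m\<^esub> z)"
    by (elim heis_cases) (simp add: heis_mult algebra_simps)
qed (auto simp: heis_one heis_mult elim!: heis_cases)

lemma heis_pow:
  "heis m 1 0 0 0 0 0 [^]\<^bsub>Heis_sq m\<^esub> (n::nat) = heis m (int n) 0 0 0 0 0"
  "heis m 0 1 0 0 0 0 [^]\<^bsub>Heis_sq m\<^esub> (n::nat) = heis m 0 (int n) 0 0 0 0"
  "heis m 0 0 1 0 0 0 [^]\<^bsub>Heis_sq m\<^esub> (n::nat) = heis m 0 0 (int n) 0 0 0"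
  "heis m 0 0 0 1 0 0 [^]\<^bsub>Heis_sq m\<^esub> (n::nat) = heis m 0 0 0 (int n) 0 0"
  "heis m 0 0 0 0 1 0 [^]\<^bsub>Heis_sq m\<^esub> (n::nat) = heis m 0 0 0 0 (int n) 0"
  "heis m 0 0 0 0 0 1 [^]\<^bsub>Heis_sq m\<^esub> (n::nat) = heis m 0 0 0 0 0 (int n)"
  by (induction n) (simp_all add: heis_one heis_mult add.commute)

text \<open>
  Since \<open>a (a - 1)\<close> is twice the integer binomial coefficient, multiplying it by the inverse of 2
  modulo \<open>m\<close> gives the class of that coefficient.
\<close>

lemma choose2_residue:
  assumes "odd m" "0 \<le> a" "a < m"
  shows "choose2 R a = int (nat a choose 2) mod m"
proof -
  have "2 < m"
    using \<open>odd m\<close> m_gt_one by (cases "m = 2") auto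
  then have 2: "\<one> \<oplus> \<one> = 2"
    by (simp add: R_m_def residue_ring_def)
  have "coprime 2 m" using \<open>odd m\<close> by simp
  then have "\<one> \<oplus> \<one> \<in> Units R"
    using \<open>2 < m\<close> by (simp add: res_units_eq 2)
  then have "(\<one> \<oplus> \<one>) \<otimes> inv (\<one> \<oplus> \<one>) = \<one>"
    using cring by (simp add: monoid.Units_r_inv ring.is_monoid cring.axioms)
  then have i: "(2 * inv (\<one> \<oplus> \<one>)) mod m = 1"
    unfolding 2 by (simp add: res_mult_eq res_one_eq)
  have "a \<ominus> \<one> = (a - 1) mod m"
    using m_gt_one by (simp add: a_minus_def res_neg_eq res_add_eq res_one_eq mod_simps)
  then have "choose2 R a = (a * (a - 1) * inv (\<one> \<oplus> \<one>)) mod m"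
    by (simp add: choose2_def res_mult_eq mod_simps)
  also have "a * (a - 1) = 2 * int (nat a choose 2)"
  proof (cases "a = 0")
    case False
    define n where "n = nat a - 1"
    have "a = int n + 1" using False assms by (simp add: n_def)
    moreover have "2 * (Suc n choose 2) = Suc n * n"
      by (simp add: choose_two)
    then have "2 * int (Suc n choose 2) = int (Suc n) * int n"
      by (metis of_nat_mult of_nat_numeral)
    ultimately show ?thesis by (simp add: nat_add_distrib del: binomial_Suc_Suc)
  qed simp
  also have "(2 * int (nat a choose 2) * inv (\<one> \<oplus> \<one>)) mod m =
      (int (nat a choose 2) * ((2 * inv (\<one> \<oplus> \<one>)) mod m)) mod m"
    by (simp add: mod_simps mult_ac)
  finally show ?thesis
    by (simp add: i)
qed

end

lemma rpow_eq_power: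
  assumes "l ^ p = 1" "e = int n mod int p"
  shows "l [^^] e = l ^ n"
proof -
  have "l ^ n = l ^ (p * (n div p) + n mod p)" by simp
  also have "\<dots> = l ^ (n mod p)"
    using assms(1) by (simp only: power_add power_mult power_one mult_1_left)
  also have "n mod p = nat e"
    using assms(2) by (simp flip: of_nat_mod)
  finally show ?thesis by (simp add: rpow_def)
qed

section \<open>Cocycles in normal form\<close>

lemma two_cocycle_div_coboundary:
  assumes "monoid G" "two_cocycle G \<alpha>" "\<And>g. g \<in> carrier G \<Longrightarrow> \<mu> g \<noteq> 0"
  shows "two_cocycle G (\<lambda>g h. \<alpha> g h / coboundary G \<mu> g h)"
  unfolding two_cocycle_def
proof (intro conjI ballI)
  interpret monoid G by fact
  fix g h k assume [simp]: "g \<in> carrier G" "h \<in> carrier G" "k \<in> carrier G"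
  have "\<alpha> g h * \<alpha> (g \<otimes>\<^bsub>G\<^esub> h) k = \<alpha> g (h \<otimes>\<^bsub>G\<^esub> k) * \<alpha> h k"
    using assms(2) by (simp add: two_cocycle_def)
  then show "\<alpha> g h / coboundary G \<mu> g h * (\<alpha> (g \<otimes>\<^bsub>G\<^esub> h) k / coboundary G \<mu> (g \<otimes>\<^bsub>G\<^esub> h) k) =
    \<alpha> g (h \<otimes>\<^bsub>G\<^esub> k) / coboundary G \<mu> g (h \<otimes>\<^bsub>G\<^esub> k) * (\<alpha> h k / coboundary G \<mu> h k)"
    using assms(3) by (simp add: coboundary_def m_assoc)
qed (use assms monoid.m_closed[OF assms(1)] in \<open>auto simp: two_cocycle_def coboundary_def\<close>)

theorem theorem5p2:
  fixes p :: nat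
    and Zp :: "int ring" (structure)
    and \<alpha> :: "(int \<times> int) mat \<Rightarrow> (int \<times> int) mat \<Rightarrow> complex"
  assumes "prime p" and "odd p"
    and "Zp = residue_ring (int p)"
    and "two_cocycle (H3 (RDirProd Zp Zp)) \<alpha>"
  shows "\<exists>\<beta> l1 l2 l3 l4 l5 l6 l7 l8.
    two_cocycle (H3 (RDirProd Zp Zp)) \<beta> \<and>
    cohomologous (H3 (RDirProd Zp Zp)) \<alpha> \<beta> \<and>
    (\<forall>l\<in>{l1, l2, l3, l4, l5, l6, l7, l8}. l \<noteq> 0 \<and> l ^ p = 1) \<and>
    (\<forall>a1 a2 b1 b2 c1 c2 a1' a2' b1' b2' c1' c2'.
      {a1, a2, b1, b2, c1, c2, a1', a2', b1', b2', c1', c2'} \<subseteq> carrier Zp \<longrightarrow>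
      \<beta> (H3_elem Zp a1 a2 b1 b2 c1 c2) (H3_elem Zp a1' a2' b1' b2' c1' c2') =
        l1 [^^] (c1' \<otimes> a1 \<oplus> b1 \<otimes> choose2 Zp a1' \<oplus> a1 \<otimes> b1 \<otimes> a1') *
        l2 [^^] (c1' \<otimes> b1 \<oplus> a1' \<otimes> choose2 Zp b1) *
        l3 [^^] (c2' \<otimes> a2 \<oplus> b2 \<otimes> choose2 Zp a2' \<oplus> a2 \<otimes> b2 \<otimes> a2') *
        l4 [^^] (c2' \<otimes> b2 \<oplus> a2' \<otimes> choose2 Zp b2) *
        l5 [^^] (a1' \<otimes> a2) * l6 [^^] (a1' \<otimes> b2) * l7 [^^] (b1' \<otimes> a2) * l8 [^^] (b1' \<otimes> b2))"
proof -
  have "1 < int p"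
    using prime_gt_1_nat[OF \<open>prime p\<close>] by simp
  then interpret Z: residues "int p" Zp
    by (rule residues.intro) (rule eq_reflection[OF assms(3)])
  let ?m = "int p"
  have Zp: "Zp = residue_ring ?m"
    by (fact assms(3))
  interpret twisted_group_algebra "Heis_sq ?m" \<alpha>
    using Z.monoid_Heis_sq assms(4)
    by (simp add: twisted_group_algebra_def twisted_group_algebra_axioms_def Zp)
  let ?x1 = "heis ?m 1 0 0 0 0 0" and ?x2 = "heis ?m 0 1 0 0 0 0"
    and ?y1 = "heis ?m 0 0 1 0 0 0" and ?y2 = "heis ?m 0 0 0 1 0 0"
    and ?z1 = "heis ?m 0 0 0 0 1 0" and ?z2 = "heis ?m 0 0 0 0 0 1"
  have heis_word: "word ?z1 ?x1 ?y1 c1 a1 b1 \<otimes>\<^bsub>Heis_sq ?m\<^esub> word ?z2 ?x2 ?y2 c2 a2 b2 = 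
      heis ?m (int a1) (int a2) (int b1) (int b2) (int c1) (int c2)" for a1 a2 b1 b2 c1 c2
    by (simp add: word_def Z.heis_pow Z.heis_mult)
  have pow_p: "heis ?m ?m 0 0 0 0 0 = \<one>\<^bsub>Heis_sq ?m\<^esub>" "heis ?m 0 ?m 0 0 0 0 = \<one>\<^bsub>Heis_sq ?m\<^esub>"
    "heis ?m 0 0 ?m 0 0 0 = \<one>\<^bsub>Heis_sq ?m\<^esub>" "heis ?m 0 0 0 ?m 0 0 = \<one>\<^bsub>Heis_sq ?m\<^esub>"
    "heis ?m 0 0 0 0 ?m 0 = \<one>\<^bsub>Heis_sq ?m\<^esub>" "heis ?m 0 0 0 0 0 ?m = \<one>\<^bsub>Heis_sq ?m\<^esub>"
    by (simp_all add: Z.heis_one heis_def)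
  obtain \<nu> l1 l2 l3 l4 l5 l6 l7 l8
  where l: "\<And>l. l \<in> {l1, l2, l3, l4, l5, l6, l7, l8} \<Longrightarrow> l \<noteq> 0 \<and> l ^ p = 1"
    and \<nu>_nonzero: "\<And>a1 a2 b1 b2 c1 c2. \<nu> a1 a2 b1 b2 c1 c2 \<noteq> 0"
    and mod: "\<And>a1 a2 b1 b2 c1 c2. \<nu> a1 a2 b1 b2 c1 c2 =
      \<nu> (a1 mod p) (a2 mod p) (b1 mod p) (b2 mod p) (c1 mod p) (c2 mod p)"
    and key: "\<And>a1 a2 b1 b2 c1 c2 a1' a2' b1' b2' c1' c2'.
      \<nu> a1 a2 b1 b2 c1 c2 * \<nu> a1' a2' b1' b2' c1' c2' *
        \<alpha> (heis ?m (int a1) (int a2) (int b1) (int b2) (int c1) (int c2))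
          (heis ?m (int a1') (int a2') (int b1') (int b2') (int c1') (int c2')) =
      l1 ^ (c1' * a1 + b1 * (a1' choose 2) + a1 * b1 * a1') * l2 ^ (c1' * b1 + a1' * (b1 choose 2)) *
      l3 ^ (c2' * a2 + b2 * (a2' choose 2) + a2 * b2 * a2') * l4 ^ (c2' * b2 + a2' * (b2 choose 2)) *
      l5 ^ (a1' * a2) * l6 ^ (a1' * b2) * l7 ^ (b1' * a2) * l8 ^ (b1' * b2) *
      \<nu> (a1 + a1') (a2 + a2') (b1 + b1') (b2 + b2') (c1 + c1' + b1 * a1') (c2 + c2' + b2 * a2')"
  proof (rule cocycle_normal_form[where p = p and ?x1.0 = ?x1 and ?x2.0 = ?x2 and ?y1.0 = ?y1 and ?y2.0 = ?y2
        and ?z1.0 = ?z1 and ?z2.0 = ?z2, unfolded heis_word], goal_cases)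
    case 21
    from 21(2-5) show thesis by (rule that)
  qed (use \<open>odd p\<close> in \<open>auto simp: Z.heis_pow Z.heis_mult pow_p\<close>)
  \<comment> \<open>The coordinates of a matrix are read off from its entries above the diagonal.\<close>
  define \<mu> where "\<mu> = (\<lambda>g::(int \<times> int) mat.
    1 / \<nu> (nat (fst (g $$ (1, 2)))) (nat (snd (g $$ (1, 2)))) (nat (fst (g $$ (0, 1))))
      (nat (snd (g $$ (0, 1)))) (nat (fst (g $$ (0, 2)))) (nat (snd (g $$ (0, 2)))))"
  have \<mu>: "\<mu> (heis ?m (int a1) (int a2) (int b1) (int b2) (int c1) (int c2)) = 1 / \<nu> a1 a2 b1 b2 c1 c2"
    for a1 a2 b1 b2 c1 c2
    unfolding mod[of a1 a2 b1 b2 c1 c2]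
    by (simp add: \<mu>_def heis_def H3_elem_eq_unitri nat_mod_distrib)
  have \<mu>_nonzero: "\<mu> g \<noteq> 0" for g
    by (simp add: \<mu>_def \<nu>_nonzero)
  define \<beta> where "\<beta> = (\<lambda>g h. \<alpha> g h / coboundary (Heis_sq ?m) \<mu> g h)"
  have 1: "two_cocycle (Heis_sq ?m) \<beta>"
    unfolding \<beta>_def by (rule two_cocycle_div_coboundary) (use Z.monoid_Heis_sq cocycle \<mu>_nonzero in auto)
  have 2: "cohomologous (Heis_sq ?m) \<alpha> \<beta>"
    unfolding cohomologous_def
    by (rule exI[of _ \<mu>]) (simp add: \<beta>_def \<mu>_nonzero coboundary_def)
  have 3: "\<beta> (heis ?m (int a1) (int a2) (int b1) (int b2) (int c1) (int c2))
      (heis ?m (int a1') (int a2') (int b1') (int b2') (int c1') (int c2')) =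
      l1 ^ (c1' * a1 + b1 * (a1' choose 2) + a1 * b1 * a1') * l2 ^ (c1' * b1 + a1' * (b1 choose 2)) *
      l3 ^ (c2' * a2 + b2 * (a2' choose 2) + a2 * b2 * a2') * l4 ^ (c2' * b2 + a2' * (b2 choose 2)) *
      l5 ^ (a1' * a2) * l6 ^ (a1' * b2) * l7 ^ (b1' * a2) * l8 ^ (b1' * b2)" (is "\<beta> ?g ?h = ?k")
    for a1 a2 b1 b2 c1 c2 a1' a2' b1' b2' c1' c2'
  proof -
    have "?g \<otimes>\<^bsub>Heis_sq ?m\<^esub> ?h = heis ?m (int (a1 + a1')) (int (a2 + a2')) (int (b1 + b1')) (int (b2 + b2'))
        (int (c1 + c1' + b1 * a1')) (int (c2 + c2' + b2 * a2'))"
      by (simp add: Z.heis_mult)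
    then have "\<beta> ?g ?h = \<nu> a1 a2 b1 b2 c1 c2 * \<nu> a1' a2' b1' b2' c1' c2' * \<alpha> ?g ?h /
        \<nu> (a1 + a1') (a2 + a2') (b1 + b1') (b2 + b2') (c1 + c1' + b1 * a1') (c2 + c2' + b2 * a2')"
      by (simp only: \<beta>_def coboundary_def \<mu>) simp
    then show ?thesis
      by (simp only: key) (simp add: \<nu>_nonzero)
  qed
  have 4: "\<beta> (H3_elem Zp a1 a2 b1 b2 c1 c2) (H3_elem Zp a1' a2' b1' b2' c1' c2') =
        l1 [^^] (c1' \<otimes> a1 \<oplus> b1 \<otimes> choose2 Zp a1' \<oplus> a1 \<otimes> b1 \<otimes> a1') *
        l2 [^^] (c1' \<otimes> b1 \<oplus> a1' \<otimes> choose2 Zp b1) *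
        l3 [^^] (c2' \<otimes> a2 \<oplus> b2 \<otimes> choose2 Zp a2' \<oplus> a2 \<otimes> b2 \<otimes> a2') *
        l4 [^^] (c2' \<otimes> b2 \<oplus> a2' \<otimes> choose2 Zp b2) *
        l5 [^^] (a1' \<otimes> a2) * l6 [^^] (a1' \<otimes> b2) * l7 [^^] (b1' \<otimes> a2) * l8 [^^] (b1' \<otimes> b2)"
    if in_Zp: "{a1, a2, b1, b2, c1, c2, a1', a2', b1', b2', c1', c2'} \<subseteq> carrier Zp"
    for a1 a2 b1 b2 c1 c2 a1' a2' b1' b2' c1' c2'
  proof -
    have nat: "\<exists>n. a = int n \<and> n < p" if "a \<in> carrier Zp" for a
      using that by (intro exI[of _ "nat a"]) (auto simp: Zp residue_ring_def)
    obtain A1 A2 B1 B2 C1 C2 A1' A2' B1' B2' C1' C2'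
      where int: "a1 = int A1" "a2 = int A2" "b1 = int B1" "b2 = int B2" "c1 = int C1" "c2 = int C2"
        "a1' = int A1'" "a2' = int A2'" "b1' = int B1'" "b2' = int B2'" "c1' = int C1'" "c2' = int C2'"
      and lt: "A1 < p" "A2 < p" "B1 < p" "B2 < p" "C1 < p" "C2 < p"
        "A1' < p" "A2' < p" "B1' < p" "B2' < p" "C1' < p" "C2' < p"
      using in_Zp nat[of a1] nat[of a2] nat[of b1] nat[of b2] nat[of c1] nat[of c2]
        nat[of a1'] nat[of a2'] nat[of b1'] nat[of b2'] nat[of c1'] nat[of c2'] by auto
    \<comment> \<open>Both elements are given by natural exponents below \<open>p\<close>, where \<open>3\<close> applies; it remains to see
      that the exponents over \<open>Zp\<close> are congruent to the natural number exponents.\<close>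
    have elem: "H3_elem Zp a1 a2 b1 b2 c1 c2 = heis ?m a1 a2 b1 b2 c1 c2"
      "H3_elem Zp a1' a2' b1' b2' c1' c2' = heis ?m a1' a2' b1' b2' c1' c2'"
      using lt by (simp_all add: heis_def int Zp)
    have choose2: "choose2 Zp (int n) = int (n choose 2) mod ?m" if "n < p" for n
      using Z.choose2_residue[of "int n"] that \<open>odd p\<close> by simp
    have rpow: "l [^^] e = l ^ n" if "l \<in> {l1, l2, l3, l4, l5, l6, l7, l8}" "e = int n mod ?m" for l e n
      using rpow_eq_power l that by blast
    show ?thesis
      unfolding elem unfolding int unfolding 3
      by (intro arg_cong2[where f = "(*)"] rpow[symmetric])
        (simp_all add: choose2 lt Z.res_mult_eq Z.res_add_eq mod_simps)
  qed
  have "\<forall>l\<in>{l1, l2, l3, l4, l5, l6, l7, l8}. l \<noteq> 0 \<and> l ^ p = 1"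
    using l by blast
  with 1[folded Zp] 2[folded Zp] 4 show ?thesis
    by - (rule exI[of _ \<beta>], rule exI[of _ l1], rule exI[of _ l2], rule exI[of _ l3],
        rule exI[of _ l4], rule exI[of _ l5], rule exI[of _ l6], rule exI[of _ l7],
        rule exI[of _ l8], intro conjI allI impI; assumption)
qed

end
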